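(* For every $n\ge1$, $LS(124/3)\sim LS(134/2)$; that is, for every integer $k$, the number of $w\in R_n(124/3)$ with $ls(w)=k$ equals the number of $w\in R_n(134/2)$ with $ls(w)=k$.
   Context: A set partition $\sigma$ of $[n]=\{1,\dots,n\}$ is written $\sigma=B_1/B_2/\dots/B_m$ with blocks ordered so that $\min B_1<\dots<\min B_m$. For $A\subseteq[n]$, the subpartition $A\cap\sigma$ is the set partition of $A$ formed by the nonempty sets $A\cap B_i$; it is standardized by replacing its smallest element by $1$, the next smallest by $2$, and so on. $\sigma$ contains a pattern $\pi$ (a set partition of some $[k]$) if some subpartition of $\sigma$ standardizes to $\pi$; otherwise $\sigma$ avoids $\pi$. $\Pi_n(\pi)$ is the set of set partitions of $[n]$ avoiding $\pi$. To $\sigma=B_1/\dots/B_m$ corresponds the word (restricted growth function) $w(\sigma)=w_1\cdots w_n$ with $w_i=j$ if $i\in B_j$. $R_n(\pi)=\{w(\sigma):\sigma\in\Pi_n(\pi)\}$. The statistic $ls$ of a word $w=w_1\cdots w_n$ is $ls(w)=\sum_{i=1}^n ls_i(w)$ with $ls_i(w)=|\{w_j: j<i,\ w_j<w_i\}|$ (counting distinct letter values). The pattern $124/3$ is the set partition $\{1,2,4\},\{3\}$ of $[4]$, and $134/2$ is $\{1,3,4\},\{2\}$. *)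

theory Defs
  imports Main "HOL-Library.Disjoint_Sets"
begin

definition set_partitions :: "nat \<Rightarrow> nat set set set" where
  "set_partitions n = {\<sigma>. partition_on {1..n} \<sigma>}"

definition subpartition :: "'a set \<Rightarrow> 'a set set \<Rightarrow> 'a set set" where
  "subpartition A \<sigma> = {A \<inter> B | B. B \<in> \<sigma> \<and> A \<inter> B \<noteq> {}}"

text \<open>An element \<open>x\<close> of a finite set \<open>A\<close> that is the \<open>r\<close>-th smallest element of \<open>A\<close>
  is replaced by \<open>r\<close>, where \<open>A\<close> is the ground set of the partition.\<close>

definition standardize :: "nat set set \<Rightarrow> nat set set" where
  "standardize \<tau> = (let A = \<Union>\<tau> in (\<lambda>B. (\<lambda>x. card {y \<in> A. y \<le> x}) ` B) ` \<tau>)"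

definition contains :: "nat set set \<Rightarrow> nat set set \<Rightarrow> bool" where
  "contains \<sigma> \<pi> \<longleftrightarrow> (\<exists>A \<subseteq> \<Union>\<sigma>. standardize (subpartition A \<sigma>) = \<pi>)"

definition avoiders :: "nat \<Rightarrow> nat set set \<Rightarrow> nat set set set" where
  "avoiders n \<pi> = {\<sigma> \<in> set_partitions n. \<not> contains \<sigma> \<pi>}"

definition block_of :: "'a set set \<Rightarrow> 'a \<Rightarrow> 'a set" where
  "block_of \<sigma> i = (THE B. B \<in> \<sigma> \<and> i \<in> B)"

text \<open>When the blocks are listed as \<open>B\<^sub>1, \<dots>, B\<^sub>m\<close> by increasing minima, \<open>B\<close> is \<open>B\<^sub>j\<close> for
  \<open>j = block_index \<sigma> B\<close>, counting from 1.\<close>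

definition block_index :: "nat set set \<Rightarrow> nat set \<Rightarrow> nat" where
  "block_index \<sigma> B = card {C \<in> \<sigma>. Min C \<le> Min B}"

definition word_of :: "nat \<Rightarrow> nat set set \<Rightarrow> nat list" where
  "word_of n \<sigma> = map (\<lambda>i. block_index \<sigma> (block_of \<sigma> i)) [1..<Suc n]"

definition avoiding_words :: "nat \<Rightarrow> nat set set \<Rightarrow> nat list set" where
  "avoiding_words n \<pi> = word_of n ` avoiders n \<pi>"

text \<open>List positions are counted from 0, so the letter \<open>w\<^sub>i\<close> is \<open>w ! (i - 1)\<close>.  Each
  summand counts distinct letter values, not positions.\<close>

definition ls :: "nat list \<Rightarrow> nat" where
  "ls w = (\<Sum>i<length w. card {w ! j | j. j < i \<and> w ! j < w ! i})"

end

theory Submission imports Defs "HOL-Library.Sublist" "HOL-Library.Multiset"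
begin

text \<open>A restricted growth function avoids \<open>124/3\<close> iff all occurrences of a letter except
  possibly the first are consecutive, and it avoids \<open>134/2\<close> iff all occurrences except possibly
  the last are consecutive.  Hence a word of the first kind is determined by its letter
  multiplicities and the word formed by the first two occurrences of every letter, and a word of
  the second kind by its multiplicities and the last two occurrences; the pairs that arise are
  the same in both cases.  Neither deletion affects being a restricted growth function, and on
  these \<open>ls\<close> is the sum of \<open>w\<^sub>i - 1\<close>, which depends on the multiplicities only.\<close>

section \<open>Words avoiding abaa\<close>

text \<open>No order between \<open>a\<close> and \<open>b\<close> is asked for: a set partition
  pattern sees only which letters are equal, so \<open>b\<close> may be smaller than
  \<open>a\<close> although the word of 134/2 itself is 1211.\<close>

definition avoids_abaa :: "'a list \<Rightarrow> bool" where
  "avoids_abaa w \<longleftrightarrow> (\<forall>a b. subseq [a, b, a, a] w \<longrightarrow> a = b)"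

definition avoids_aaba :: "'a list \<Rightarrow> bool" where
  "avoids_aaba w \<longleftrightarrow> (\<forall>a b. subseq [a, a, b, a] w \<longrightarrow> a = b)"

lemma subseq_rev: "subseq u w \<Longrightarrow> subseq (rev u) (rev w)"
proof (induction rule: list_emb.induct)
  case (list_emb_Cons2 x y u w)
  then show ?case using list_emb_append_mono[of "(=)" "rev u" "rev w" "[x]" "[y]"] by simp
qed auto

text \<open>Reversal exchanges the two patterns, so the bijection is built for abaa only and then
  transported to aaba.\<close>

lemma avoids_abaa_rev: "avoids_abaa (rev w) \<longleftrightarrow> avoids_aaba w"
proof -
  have "subseq [a, b, a, a] (rev w) \<longleftrightarrow> subseq [a, a, b, a] w" for a b
    using subseq_rev[of "[a, a, b, a]" w] subseq_rev[of "[a, b, a, a]" "rev w"] by auto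
  then show ?thesis by (simp add: avoids_abaa_def avoids_aaba_def)
qed

lemma subseq_pair_same_iff: "subseq [x, x] w \<longleftrightarrow> 2 \<le> count (mset w) x"
proof (induction w)
  case (Cons y w)
  have "subseq [x] w \<longleftrightarrow> 0 < count (mset w) x"
    by (simp add: subseq_singleton_left count_greater_zero_iff)
  with Cons show ?case by (cases "x = y") (auto simp: subseq_Cons2_iff)
qed simp

text \<open>This recursion drives the inductions on avoiding words. A new occurrence has to start at
  the added \<open>x\<close>; if \<open>w\<close> begins with \<open>x\<close> too, that head can
  replace it, so the occurrence was already in \<open>w\<close>. If \<open>w\<close> has two copies
  of \<open>x\<close> but another head \<open>y\<close>, then \<open>x\<close>, \<open>y\<close>,
  \<open>x\<close>, \<open>x\<close> is a forbidden subsequence.\<close>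

lemma avoids_abaa_Cons:
  "avoids_abaa (x # w) \<longleftrightarrow> avoids_abaa w \<and> (2 \<le> count (mset w) x \<longrightarrow> hd w = x)"
proof
  assume L: "avoids_abaa (x # w)"
  have "avoids_abaa w"
    using L unfolding avoids_abaa_def by (meson list_emb_Cons)
  moreover have "hd w = x" if c: "2 \<le> count (mset w) x"
  proof (cases w)
    case Nil
    with c show ?thesis by simp
  next
    case (Cons y v)
    show ?thesis
    proof (rule ccontr)
      assume "hd w \<noteq> x"
      then have "y \<noteq> x" using Cons by simp
      with c Cons have "subseq [x, x] v" by (simp add: subseq_pair_same_iff)
      then have "subseq [x, y, x, x] (x # w)" using Cons by simp
      with L \<open>y \<noteq> x\<close> show False unfolding avoids_abaa_def by blast
    qed
  qed
  ultimately show "avoids_abaa w \<and> (2 \<le> count (mset w) x \<longrightarrow> hd w = x)" by blast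
next
  assume R: "avoids_abaa w \<and> (2 \<le> count (mset w) x \<longrightarrow> hd w = x)"
  show "avoids_abaa (x # w)" unfolding avoids_abaa_def
  proof (intro allI impI)
    fix a b assume s: "subseq [a, b, a, a] (x # w)"
    show "a = b"
    proof (rule ccontr)
      assume ne: "a \<noteq> b"
      with R have nw: "\<not> subseq [a, b, a, a] w" unfolding avoids_abaa_def by blast
      with s have xa: "x = a" and s': "subseq [b, a, a] w"
        by (auto simp: subseq_Cons2_iff split: if_splits)
      have "subseq [a, a] w" using s' by (rule subseq_Cons')
      with R xa have "hd w = a" by (simp add: subseq_pair_same_iff)
      with s' obtain v where "w = a # v" by (cases w) auto
      with s' ne nw show False by (auto simp: subseq_Cons2_iff)
    qed
  qed
qed

lemma avoids_abaa_Nil [simp]: "avoids_abaa []"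
  by (simp add: avoids_abaa_def)

section \<open>Compression to the last two occurrences of each letter, and its inverse\<close>

fun last_two :: "'a list \<Rightarrow> 'a list" where
  "last_two [] = []"
| "last_two (x # w) = (if 2 \<le> count (mset w) x then last_two w else x # last_two w)"

text \<open>In a compressed word, an entry followed by a later copy of itself is the last but one
  occurrence of its letter. It stands for the run of all copies but the last, whence the
  \<open>count M x - 1\<close> copies.\<close>

fun expand :: "'a multiset \<Rightarrow> 'a list \<Rightarrow> 'a list" where
  "expand M [] = []"
| "expand M (x # c) = (if x \<in> set c then replicate (count M x - 1) x else [x]) @ expand M c"

lemma count_last_two: "count (mset (last_two w)) a = min 2 (count (mset w) a)"
  by (induction w) auto

lemma set_last_two: "set (last_two w) = set w"
proof -
  have "x \<in> set (last_two w) \<longleftrightarrow> x \<in> set w" for x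
    using count_last_two[of w x]
    by (metis count_eq_zero_iff min_0R min_def set_mset_mset zero_neq_numeral)
  then show ?thesis by blast
qed

text \<open>Only a letter with at least two later copies is dropped, and in an avoiding word such a
  head is followed at once by another copy of itself.\<close>

lemma hd_last_two: "avoids_abaa w \<Longrightarrow> w \<noteq> [] \<Longrightarrow> hd (last_two w) = hd w"
  by (induction w) (force simp: avoids_abaa_Cons)+

text \<open>A letter with a single occurrence in \<open>c\<close> is copied without consulting
  \<open>M\<close>. This lets the next induction change the multiplicity of the letter just
  added.\<close>

lemma expand_cong:
  "(\<And>a. 2 \<le> count (mset c) a \<Longrightarrow> count M a = count N a) \<Longrightarrow> expand M c = expand N c"
proof (induction c)
  case (Cons x c)
  have "expand M c = expand N c"
  proof (rule Cons.IH)
    show "count M a = count N a" if "2 \<le> count (mset c) a" for a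
      by (rule Cons.prems, rule order_trans[OF that]) simp
  qed
  moreover have "count M x = count N x" if "x \<in> set c"
    using that by (intro Cons.prems) (simp add: Suc_le_eq count_greater_zero_iff)
  ultimately show ?case by simp
qed simp

lemma expand_last_two: "avoids_abaa w \<Longrightarrow> expand (mset w) (last_two w) = w"
proof (induction w)
  case (Cons x w)
  have av: "avoids_abaa w" and h: "2 \<le> count (mset w) x \<Longrightarrow> hd w = x"
    using Cons.prems by (auto simp: avoids_abaa_Cons)
  have IH: "expand (mset w) (last_two w) = w" using Cons.IH av .
  show ?case
  proof (cases "2 \<le> count (mset w) x")
    case False
    \<comment> \<open>\<open>x\<close> occurs at most once in \<open>last_two w\<close>, so
      \<open>expand\<close> does not notice the additional copy of \<open>x\<close> in the
      multiset.\<close>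
    have "expand (mset (x # w)) (last_two w) = expand (mset w) (last_two w)"
      using False by (intro expand_cong) (auto simp: count_last_two)
    moreover have "count (mset w) x = 1" if "x \<in> set w"
      using that False by (metis One_nat_def count_greater_zero_iff less_2_cases not_gr_zero not_le_imp_less set_mset_mset)
    ultimately show ?thesis using False IH by (simp add: set_last_two)
  next
    case True
    then have "w \<noteq> []" by auto
    then have "last_two w \<noteq> []" using set_last_two[of w] by auto
    \<comment> \<open>The dropped \<open>x\<close> is followed by another \<open>x\<close>, which
      heads the compressed word too. It is the last but one copy there, so the larger multiplicity
      of \<open>x\<close> merely lengthens this run by one.\<close>
    then obtain c where c: "last_two w = x # c"
      using hd_last_two[OF av \<open>w \<noteq> []\<close>] h[OF True] by (cases "last_two w") auto
    have c1: "count (mset c) x = 1"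
      using count_last_two[of w x] True by (simp add: c)
    then have xc: "x \<in> set c" by (metis count_mset_0_iff zero_neq_one)
    have "expand (mset (x # w)) c = expand (mset w) c"
      using c1 by (intro expand_cong) auto
    moreover have "replicate (count (mset w) x) x = x # replicate (count (mset w) x - 1) x"
      using True by (cases "count (mset w) x") auto
    ultimately show ?thesis using IH True xc by (simp add: c)
  qed
qed simp

lemma last_two_replicate_append:
  "0 < m \<Longrightarrow> count (mset v) x = 1 \<Longrightarrow> last_two (replicate m x @ v) = x # last_two v"
proof (induction m)
  case (Suc m)
  then show ?case by (cases m) auto
qed simp

lemma avoids_abaa_replicate_append:
  "count (mset v) x = 1 \<Longrightarrow> avoids_abaa v \<Longrightarrow> avoids_abaa (replicate m x @ v)"
proof (induction m)
  case (Suc m)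
  then show ?case by (cases m) (auto simp: avoids_abaa_Cons)
qed simp

text \<open>The induction shortens \<open>c\<close> and keeps \<open>M\<close>, so a suffix may
  contain fewer copies of a letter than \<open>M\<close> prescribes. Hence
  \<open>mset (expand M c) = M\<close> is too strong for the induction; the third conjunct describes
  the count that a suffix really yields, and \<open>M\<close> is constrained only at letters
  occurring twice in \<open>c\<close>.\<close>

lemma expand_correct:
  assumes "\<And>a. count (mset c) a \<le> 2"
    and "\<And>a. count (mset c) a = 2 \<Longrightarrow> 2 \<le> count M a"
  shows "avoids_abaa (expand M c) \<and> last_two (expand M c) = c \<and>
    (\<forall>a. count (mset (expand M c)) a =
       (if count (mset c) a = 2 then count M a else count (mset c) a))"
  using assms
proof (induction c)
  case (Cons x c)
  have le: "count (mset c) a \<le> 2" for a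
    using Cons.prems(1)[of a] by (auto split: if_splits)
  have le1: "count (mset c) x \<le> 1" using Cons.prems(1)[of x] by simp
  have M: "2 \<le> count M a" if "count (mset c) a = 2" for a
    using Cons.prems(2)[of a] that le1 by (cases "a = x") auto
  from Cons.IH[OF le M]
  have av: "avoids_abaa (expand M c)" and l: "last_two (expand M c) = c"
    and cnt: "count (mset (expand M c)) a =
       (if count (mset c) a = 2 then count M a else count (mset c) a)" for a by auto
  \<comment> \<open>At most one \<open>x\<close> is left in \<open>c\<close>, so
    \<open>expand\<close> adds no copies of \<open>x\<close> there: what is put in front meets
    exactly one later \<open>x\<close> or none.\<close>
  have cx: "count (mset (expand M c)) x = count (mset c) x" using cnt[of x] le1 by auto
  show ?case
  proof (cases "x \<in> set c")
    case True
    then have c1: "count (mset c) x = 1" using le1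
      by (metis count_mset_0_iff le_antisym less_one linorder_not_le)
    then have M2: "2 \<le> count M x" using Cons.prems(2)[of x] by simp
    have "count (mset (expand M c)) x = 1" using cx c1 by simp
    then show ?thesis
      using True M2 c1 av l cnt
        last_two_replicate_append[of "count M x - 1" "expand M c" x]
        avoids_abaa_replicate_append[of "expand M c" x "count M x - 1"]
      by auto
  next
    case False
    then have c0: "count (mset c) x = 0" by (simp add: count_eq_zero_iff)
    then show ?thesis using False cx av l cnt
      by (auto simp: avoids_abaa_Cons c0 simp del: count_mset_0_iff)
  qed
qed simp

text \<open>The condition on the image mentions only multiplicities, so every arrangement of the
  truncated multiset is allowed and the set of pairs is closed under reversing \<open>c\<close>.
  Hence it can serve both patterns.\<close>

lemma bij_betw_last_two:
  "bij_betw (\<lambda>w. (last_two w, mset w)) {w :: 'a list. avoids_abaa w}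
     {(c :: 'a list, M). \<forall>a. count (mset c) a = min 2 (count M a)}"
proof (rule bij_betw_byWitness[where f' = "\<lambda>(c, M). expand M c"])
  show "\<forall>w \<in> {w :: 'a list. avoids_abaa w}. (case (last_two w, mset w) of (c, M) \<Rightarrow> expand M c) = w"
    by (simp add: expand_last_two)
  have *: "avoids_abaa (expand M c) \<and> last_two (expand M c) = c \<and> mset (expand M c) = M"
    if "\<forall>a. count (mset c) a = min 2 (count M a)" for c :: "'a list" and M
  proof -
    have "avoids_abaa (expand M c) \<and> last_two (expand M c) = c \<and>
      (\<forall>a. count (mset (expand M c)) a =
         (if count (mset c) a = 2 then count M a else count (mset c) a))"
      using that by (intro expand_correct) auto
    then show ?thesis using that by (auto intro!: multiset_eqI)
  qed
  show "\<forall>p \<in> {(c :: 'a list, M). \<forall>a. count (mset c) a = min 2 (count M a)}.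
      (last_two (case p of (c, M) \<Rightarrow> expand M c), mset (case p of (c, M) \<Rightarrow> expand M c)) = p"
  proof
    fix p :: "'a list \<times> 'a multiset"
    assume "p \<in> {(c :: 'a list, M). \<forall>a. count (mset c) a = min 2 (count M a)}"
    then have "\<forall>a. count (mset (fst p)) a = min 2 (count (snd p) a)" by (simp add: split_beta)
    from *[OF this] show "(last_two (case p of (c, M) \<Rightarrow> expand M c),
        mset (case p of (c, M) \<Rightarrow> expand M c)) = p" by (simp add: split_beta)
  qed
  show "(\<lambda>w. (last_two w, mset w)) ` {w :: 'a list. avoids_abaa w}
      \<subseteq> {(c :: 'a list, M). \<forall>a. count (mset c) a = min 2 (count M a)}"
    by (auto simp: count_last_two)
  show "(\<lambda>(c, M). expand M c) ` {(c :: 'a list, M). \<forall>a. count (mset c) a = min 2 (count M a)}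
      \<subseteq> {w :: 'a list. avoids_abaa w}"
    using * by auto
qed

text \<open>Reverse the word, compress, and reverse the result: \<open>rev\<close> swaps the two
  classes of words, keeps \<open>mset\<close>, and maps the set of pairs onto itself.\<close>

lemma bij_betw_first_two:
  "bij_betw (\<lambda>w. (rev (last_two (rev w)), mset w)) {w. avoids_aaba w}
     {(c, M). \<forall>a. count (mset c) a = min 2 (count M a)}"
proof -
  let ?X = "{(c :: 'a list, M). \<forall>a. count (mset c) a = min 2 (count M a)}"
  have r: "bij_betw rev {w :: 'a list. avoids_aaba w} {w. avoids_abaa w}"
    by (rule bij_betw_byWitness[where f' = rev]) (auto simp: avoids_abaa_rev[symmetric])
  have s: "bij_betw (\<lambda>(c, M). (rev c, M)) ?X ?X"
    by (rule bij_betw_byWitness[where f' = "\<lambda>(c, M). (rev c, M)"]) auto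
  show ?thesis
    using bij_betw_trans[OF bij_betw_trans[OF r bij_betw_last_two] s] by (simp add: comp_def)
qed

section \<open>Restricted growth functions\<close>

text \<open>Letters in \<open>S\<close> count as having occurred before the word starts.\<close>

definition rgf :: "nat set \<Rightarrow> nat list \<Rightarrow> bool" where
  "rgf S w \<longleftrightarrow> (\<forall>i<length w. 0 < w ! i \<and> {0<..<w ! i} \<subseteq> S \<union> set (take i w))"

lemma rgf_Nil [simp]: "rgf S []"
  by (simp add: rgf_def)

lemma rgf_Cons: "rgf S (x # w) \<longleftrightarrow> 0 < x \<and> {0<..<x} \<subseteq> S \<and> rgf (insert x S) w"
  unfolding rgf_def by (simp add: All_less_Suc2)

lemma rgf_snoc: "rgf S (w @ [x]) \<longleftrightarrow> rgf S w \<and> 0 < x \<and> {0<..<x} \<subseteq> S \<union> set w"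
  by (induction w arbitrary: S) (auto simp: rgf_Cons)

lemma rgf_predecessors:
  assumes "rgf S w" "x \<in> set w"
  shows "0 < x \<and> {0<..<x} \<subseteq> S \<union> set w"
  using assms by (auto simp: rgf_def in_set_conv_nth dest!: in_set_takeD)

text \<open>In an avoiding word a dropped letter is immediately followed by a copy of itself, and
  doubling a letter on the spot imposes no new condition. \<open>S\<close> is arbitrary because each
  kept letter joins it.\<close>

lemma rgf_last_two: "avoids_abaa w \<Longrightarrow> rgf S (last_two w) \<longleftrightarrow> rgf S w"
proof (induction w arbitrary: S)
  case (Cons x w)
  then have IH: "rgf T (last_two w) \<longleftrightarrow> rgf T w" for T by (simp add: avoids_abaa_Cons)
  show ?case
  proof (cases "2 \<le> count (mset w) x")
    case True
    with Cons.prems have "hd w = x" by (simp add: avoids_abaa_Cons)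
    moreover have "w \<noteq> []" using True by auto
    ultimately obtain v where w: "w = x # v" by (cases w) simp_all
    have "rgf S (x # x # v) \<longleftrightarrow> rgf S (x # v)"
      by (simp add: rgf_Cons subset_insertI2 cong: conj_cong)
    then have "rgf S (x # w) \<longleftrightarrow> rgf S w" unfolding w .
    moreover have "last_two (x # w) = last_two w" using True by simp
    ultimately show ?thesis by (simp only: IH)
  qed (simp add: IH rgf_Cons)
qed simp

text \<open>A dropped letter has occurred earlier, so its predecessors are present, and removing it
  takes no letter away from later positions. Induction runs from the right end, since the head of
  \<open>rev w\<close> is the last letter of \<open>w\<close>.\<close>

lemma rgf_first_two: "rgf S (rev (last_two (rev w))) \<longleftrightarrow> rgf S w"
proof (induction w rule: rev_induct)
  case (snoc x w)
  show ?case
  proof (cases "2 \<le> count (mset w) x")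
    case True
    then have "x \<in> set w" by (metis count_mset_0_iff not_numeral_le_zero)
    then have "rgf S (w @ [x]) \<longleftrightarrow> rgf S w"
      using rgf_predecessors by (auto simp: rgf_snoc)
    with True snoc.IH show ?thesis by simp
  qed (simp add: snoc.IH rgf_snoc set_last_two)
qed simp

text \<open>The distinct smaller letters before position \<open>i\<close> are exactly 1 up to
  \<open>w ! i - 1\<close>: letters are positive, and the growth condition makes each smaller value
  appear earlier.\<close>

lemma ls_rgf:
  assumes "rgf {} w"
  shows "ls w = (\<Sum>x\<in>#mset w. x - 1)"
proof -
  have "{w ! j | j. j < i \<and> w ! j < w ! i} = {0<..<w ! i}" if "i < length w" for i
  proof
    show "{w ! j | j. j < i \<and> w ! j < w ! i} \<subseteq> {0<..<w ! i}"
      using assms that by (auto simp: rgf_def)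
    show "{0<..<w ! i} \<subseteq> {w ! j | j. j < i \<and> w ! j < w ! i}"
    proof
      fix x assume x: "x \<in> {0<..<w ! i}"
      with assms that have "x \<in> set (take i w)" unfolding rgf_def by blast
      with x that show "x \<in> {w ! j | j. j < i \<and> w ! j < w ! i}"
        by (auto simp: in_set_conv_nth)
    qed
  qed
  then have "ls w = (\<Sum>i<length w. w ! i - 1)" by (simp add: ls_def)
  also have "\<dots> = sum_list (map (\<lambda>x. x - 1) w)"
    by (simp add: sum_list_sum_nth atLeast0LessThan)
  also have "\<dots> = (\<Sum>x\<in>#mset w. x - 1)" by (simp add: sum_mset_sum_list flip: mset_map)
  finally show ?thesis .
qed

section \<open>Words of set partitions\<close>

lemma block_of_eq:
  assumes "partition_on A P" "B \<in> P" "i \<in> B"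
  shows "block_of P i = B"
  unfolding block_of_def
proof (rule the_equality)
  show "C = B" if "C \<in> P \<and> i \<in> C" for C
    using that assms by (meson disjointD disjoint_iff partition_onD2)
qed (use assms in simp)

lemma block_of_in:
  assumes "partition_on A P" "i \<in> A"
  shows "block_of P i \<in> P" "i \<in> block_of P i"
proof -
  obtain B where "B \<in> P" "i \<in> B" using assms by (auto simp: partition_on_def)
  then show "block_of P i \<in> P" "i \<in> block_of P i" using block_of_eq[OF assms(1)] by auto
qed

lemma block_of_eq_iff:
  assumes "partition_on A P" "i \<in> A" "j \<in> A"
  shows "block_of P i = block_of P j \<longleftrightarrow> (\<exists>B\<in>P. i \<in> B \<and> j \<in> B)"
  using block_of_in[OF assms(1)] block_of_eq[OF assms(1)] assms(2,3) by metis

text \<open>Each block is recovered as the class of any of its elements. So a partition is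
  determined by the relation of lying in the same block, which is how equality of partitions is
  tested below.\<close>

lemma partition_on_conv_block_of:
  assumes "partition_on A P"
  shows "P = (\<lambda>i. {j \<in> A. block_of P j = block_of P i}) ` A"
proof -
  have B: "{j \<in> A. block_of P j = block_of P i} = block_of P i" if "i \<in> A" for i
    using assms that block_of_in[OF assms] block_of_eq[OF assms] partition_onD1[OF assms] by blast
  have "P = block_of P ` A"
  proof
    show "P \<subseteq> block_of P ` A"
    proof
      fix C assume C: "C \<in> P"
      then obtain i where "i \<in> C" using assms by (metis all_not_in_conv partition_onD3)
      with C show "C \<in> block_of P ` A"
        using block_of_eq[OF assms] partition_onD1[OF assms] by blast
    qed
  qed (use block_of_in[OF assms] in blast)
  then show ?thesis using B by auto
qed

lemma partition_on_eqI:
  assumes "partition_on A P" "partition_on A Q"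
    and "\<And>i j. i \<in> A \<Longrightarrow> j \<in> A \<Longrightarrow> block_of P i = block_of P j \<longleftrightarrow> block_of Q i = block_of Q j"
  shows "P = Q"
proof -
  have "P = (\<lambda>i. {j \<in> A. block_of P j = block_of P i}) ` A"
    by (rule partition_on_conv_block_of[OF assms(1)])
  also have "\<dots> = (\<lambda>i. {j \<in> A. block_of Q j = block_of Q i}) ` A"
    using assms(3) by (intro image_cong) auto
  also have "\<dots> = Q" by (rule partition_on_conv_block_of[OF assms(2), symmetric])
  finally show ?thesis .
qed

section \<open>Numbering blocks by their minima\<close>

lemma finite_blocks:
  assumes "partition_on {1..n::nat} \<sigma>"
  shows "finite \<sigma>" "B \<in> \<sigma> \<Longrightarrow> finite B" "B \<in> \<sigma> \<Longrightarrow> B \<noteq> {}" "B \<in> \<sigma> \<Longrightarrow> B \<subseteq> {1..n}"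
proof -
  show "finite \<sigma>" using assms by (rule finite_elements[rotated]) simp
  show "B \<in> \<sigma> \<Longrightarrow> B \<subseteq> {1..n}" using assms by (auto simp: partition_on_def)
  then show "B \<in> \<sigma> \<Longrightarrow> finite B" by (meson finite_atLeastAtMost finite_subset)
  show "B \<in> \<sigma> \<Longrightarrow> B \<noteq> {}" using assms by (auto simp: partition_on_def)
qed

lemma inj_on_Min_blocks:
  assumes "partition_on {1..n::nat} \<sigma>"
  shows "inj_on Min \<sigma>"
proof (rule inj_onI)
  fix B C assume "B \<in> \<sigma>" "C \<in> \<sigma>" "Min B = Min C"
  then show "B = C"
    by (metis assms block_of_eq Min_in finite_blocks(2,3))
qed

lemma block_index_less_iff:
  assumes "partition_on {1..n} \<sigma>" "B \<in> \<sigma>" "C \<in> \<sigma>"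
  shows "block_index \<sigma> B < block_index \<sigma> C \<longleftrightarrow> Min B < Min C"
proof -
  have fin: "finite {D \<in> \<sigma>. Min D \<le> m}" for m using finite_blocks(1)[OF assms(1)] by simp
  show ?thesis
  proof
    assume "Min B < Min C"
    then have "{D \<in> \<sigma>. Min D \<le> Min B} \<subset> {D \<in> \<sigma>. Min D \<le> Min C}"
      using assms by force
    then show "block_index \<sigma> B < block_index \<sigma> C"
      unfolding block_index_def by (rule psubset_card_mono[OF fin])
  next
    assume L: "block_index \<sigma> B < block_index \<sigma> C"
    show "Min B < Min C"
    proof (rule ccontr)
      assume "\<not> Min B < Min C"
      then have "{D \<in> \<sigma>. Min D \<le> Min C} \<subseteq> {D \<in> \<sigma>. Min D \<le> Min B}" by auto
      then have "block_index \<sigma> C \<le> block_index \<sigma> B"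
        unfolding block_index_def by (rule card_mono[OF fin])
      with L show False by simp
    qed
  qed
qed

lemma inj_on_block_index:
  assumes "partition_on {1..n} \<sigma>"
  shows "inj_on (block_index \<sigma>) \<sigma>"
proof (rule inj_onI)
  fix B C assume BC: "B \<in> \<sigma>" "C \<in> \<sigma>" "block_index \<sigma> B = block_index \<sigma> C"
  then have "Min B = Min C"
    using block_index_less_iff[OF assms] by (metis less_irrefl linorder_neqE_nat)
  with BC show "B = C" using inj_on_Min_blocks[OF assms] by (simp add: inj_on_def)
qed

lemma block_index_pos:
  assumes "partition_on {1..n} \<sigma>" "B \<in> \<sigma>"
  shows "0 < block_index \<sigma> B"
  unfolding block_index_def using assms finite_blocks(1)[OF assms(1)]
  by (auto simp: card_gt_0_iff)

text \<open>The indices leave no gap: \<open>block_index\<close> is injective and sends the blocks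
  with smaller minima into an interval with as many elements as there are such blocks. This is the
  source of the growth condition.\<close>

lemma block_index_below:
  assumes "partition_on {1..n} \<sigma>" "B \<in> \<sigma>"
  shows "block_index \<sigma> ` {C \<in> \<sigma>. Min C < Min B} = {0<..<block_index \<sigma> B}"
proof (rule card_subset_eq)
  let ?L = "{C \<in> \<sigma>. Min C < Min B}"
  show "block_index \<sigma> ` ?L \<subseteq> {0<..<block_index \<sigma> B}"
    using block_index_pos[OF assms(1)] block_index_less_iff[OF assms(1)] assms(2) by auto
  have "{C \<in> \<sigma>. Min C \<le> Min B} = insert B ?L"
    using assms(2) inj_on_Min_blocks[OF assms(1)] by (auto simp: inj_on_def le_less)
  then have "block_index \<sigma> B = Suc (card ?L)"
    unfolding block_index_def using finite_blocks(1)[OF assms(1)] by simp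
  moreover have "card (block_index \<sigma> ` ?L) = card ?L"
    by (rule card_image) (rule inj_on_subset[OF inj_on_block_index[OF assms(1)]], auto)
  ultimately show "card (block_index \<sigma> ` ?L) = card {0<..<block_index \<sigma> B}" by simp
qed simp

section \<open>Restricted growth functions as the words of partitions\<close>

lemma length_word_of [simp]: "length (word_of n \<sigma>) = n"
  by (simp add: word_of_def)

lemma nth_word_of: "i < n \<Longrightarrow> word_of n \<sigma> ! i = block_index \<sigma> (block_of \<sigma> (Suc i))"
  by (simp add: word_of_def del: upt_Suc)

lemma word_of_eq_iff:
  assumes "partition_on {1..n} \<sigma>" "i < n" "j < n"
  shows "word_of n \<sigma> ! i = word_of n \<sigma> ! j \<longleftrightarrow>
    block_of \<sigma> (Suc i) = block_of \<sigma> (Suc j)"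
proof -
  have "block_of \<sigma> (Suc i) \<in> \<sigma>" "block_of \<sigma> (Suc j) \<in> \<sigma>"
    using block_of_in(1)[OF assms(1)] assms(2,3) by auto
  then show ?thesis using inj_on_block_index[OF assms(1)] assms(2,3)
    by (auto simp: nth_word_of inj_on_def)
qed

lemma rgf_word_of:
  assumes "partition_on {1..n} \<sigma>"
  shows "rgf {} (word_of n \<sigma>)"
  unfolding rgf_def
proof (intro allI impI conjI)
  fix i assume "i < length (word_of n \<sigma>)"
  then have i: "i < n" by simp
  let ?B = "block_of \<sigma> (Suc i)"
  have B: "?B \<in> \<sigma>" "Suc i \<in> ?B" using block_of_in[OF assms] i by auto
  show "0 < word_of n \<sigma> ! i" using block_index_pos[OF assms B(1)] i by (simp add: nth_word_of)
  show "{0<..<word_of n \<sigma> ! i} \<subseteq> {} \<union> set (take i (word_of n \<sigma>))"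
  proof
    fix v assume "v \<in> {0<..<word_of n \<sigma> ! i}"
    then have "v \<in> block_index \<sigma> ` {C \<in> \<sigma>. Min C < Min ?B}"
      using block_index_below[OF assms B(1)] i by (simp add: nth_word_of)
    then obtain C where C: "C \<in> \<sigma>" "Min C < Min ?B" "v = block_index \<sigma> C" by auto
    \<comment> \<open>The block with index \<open>v\<close> starts before \<open>?B\<close>, hence
      before the element \<open>Suc i\<close>, and its minimum marks an earlier position carrying
      the letter \<open>v\<close>. The element \<open>Suc j\<close> sits at list position
      \<open>j\<close>.\<close>
    have "Min ?B \<le> Suc i" using B finite_blocks(2)[OF assms] by simp
    moreover have mC: "Min C \<in> C" using C finite_blocks[OF assms] by simp
    moreover have "Min C \<ge> 1" using mC finite_blocks(4)[OF assms C(1)] by auto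
    ultimately obtain j where j: "Min C = Suc j" "j < i" using C(2)
      by (cases "Min C") auto
    have "word_of n \<sigma> ! j = v"
      using j i C mC block_of_eq[OF assms C(1)] by (simp add: nth_word_of)
    then show "v \<in> {} \<union> set (take i (word_of n \<sigma>))"
      using j i by (auto simp: in_set_conv_nth intro!: exI[of _ j])
  qed
qed

text \<open>The blocks are the level sets of \<open>w\<close>. The growth condition makes their
  minima increase with the letter, so numbering by minima returns the letter itself.\<close>

lemma rgf_imp_word_of:
  assumes "rgf {} w"
  obtains \<sigma> where "partition_on {1..length w} \<sigma>" "word_of (length w) \<sigma> = w"
proof -
  define n where "n = length w"
  define K where "K v = {i \<in> {1..n}. w ! (i - 1) = v}" for v
  define \<sigma> where "\<sigma> = K ` set w"
  have mem: "Suc i \<in> K (w ! i)" if "i < n" for i using that by (auto simp: K_def)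
  have Kne: "K v \<noteq> {}" if "v \<in> set w" for v
    using that mem by (metis empty_iff in_set_conv_nth n_def)
  have fin: "finite (K v)" for v by (simp add: K_def)
  have injK: "inj_on K (set w)"
    using Kne by (auto simp: inj_on_def K_def)
  have part: "partition_on {1..n} \<sigma>"
  proof (rule partition_onI)
    show "\<Union>\<sigma> = {1..n}" by (force simp: \<sigma>_def K_def n_def)
    show "disjnt p q" if "p \<in> \<sigma>" "q \<in> \<sigma>" "p \<noteq> q" for p q
      using that by (auto simp: \<sigma>_def K_def disjnt_def)
    show "{} \<notin> \<sigma>" using Kne by (auto simp: \<sigma>_def)
  qed
  have Min_less: "Min (K v) < Min (K u)" if "v < u" "v \<in> set w" "u \<in> set w" for u v
  proof -
    have "Min (K u) \<in> K u" using Min_in[OF fin Kne[OF that(3)]] .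
    then obtain i where i: "i < n" "w ! i = u" "Min (K u) = Suc i"
      by (cases "Min (K u)") (auto simp: K_def)
    \<comment> \<open>Position \<open>i\<close> is the first occurrence of \<open>u\<close>; the
      growth condition there forces the smaller positive letter \<open>v\<close> to occur
      earlier.\<close>
    have v0: "0 < v" using rgf_predecessors[OF assms that(2)] by simp
    then have "v \<in> set (take i w)" using assms i that(1) unfolding rgf_def n_def by force
    then obtain j where j: "j < i" "w ! j = v" using i by (auto simp: in_set_conv_nth)
    then have "Min (K v) \<le> Suc j" using mem[of j] i fin by (intro Min_le) auto
    with j i show ?thesis by simp
  qed
  have idx: "block_index \<sigma> (K v) = v" if v: "v \<in> set w" for v
  proof -
    have "Min (K u) \<le> Min (K v) \<longleftrightarrow> u \<le> v" if "u \<in> set w" for u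
      using Min_less[of u v] Min_less[of v u] that v
      by (metis le_less_linear le_less less_asym linorder_neqE_nat)
    then have "{C \<in> \<sigma>. Min C \<le> Min (K v)} = K ` {u \<in> set w. u \<le> v}"
      by (auto simp: \<sigma>_def)
    \<comment> \<open>The letters of \<open>w\<close> not exceeding \<open>v\<close> are all of 1 up
      to \<open>v\<close>, so counting their blocks gives \<open>v\<close>.\<close>
    also have "{u \<in> set w. u \<le> v} = {0<..v}"
    proof
      show "{u \<in> set w. u \<le> v} \<subseteq> {0<..v}" using rgf_predecessors[OF assms] by auto
      show "{0<..v} \<subseteq> {u \<in> set w. u \<le> v}"
      proof
        fix u assume u: "u \<in> {0<..v}"
        then show "u \<in> {u \<in> set w. u \<le> v}"
          using rgf_predecessors[OF assms v] v by (cases "u = v") auto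
      qed
    qed
    finally have e: "{C \<in> \<sigma>. Min C \<le> Min (K v)} = K ` {0<..v}" .
    have "{0<..v} \<subseteq> set w"
    proof
      fix u assume u: "u \<in> {0<..v}"
      then show "u \<in> set w"
        using rgf_predecessors[OF assms v] v by (cases "u = v") auto
    qed
    then have "card (K ` {0<..v}) = v"
      using card_image[OF inj_on_subset[OF injK]] by simp
    then show ?thesis by (simp add: block_index_def e)
  qed
  have "word_of n \<sigma> = w"
  proof (rule nth_equalityI)
    fix i assume "i < length (word_of n \<sigma>)"
    then have i: "i < n" by simp
    have "block_of \<sigma> (Suc i) = K (w ! i)"
      using i by (intro block_of_eq[OF part] mem) (auto simp: \<sigma>_def n_def)
    then show "word_of n \<sigma> ! i = w ! i" using i idx by (simp add: nth_word_of n_def)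
  qed (simp add: n_def)
  with part show ?thesis using that by (simp add: n_def)
qed

section \<open>Pattern containment\<close>

text \<open>Standardizing amounts to pulling blocks back along the increasing enumeration
  \<open>f\<close> of the chosen set, because the rank of \<open>f i\<close> in that set is
  \<open>i\<close>. Removing \<open>{}\<close> discards the blocks that miss the set.\<close>

lemma standardize_subpartition:
  fixes f :: "nat \<Rightarrow> nat"
  assumes "strict_mono_on {1..k} f" "f ` {1..k} \<subseteq> \<Union>\<sigma>"
  shows "standardize (subpartition (f ` {1..k}) \<sigma>) =
    (\<lambda>B. {i \<in> {1..k}. f i \<in> B}) ` \<sigma> - {{}}"
proof -
  let ?A = "f ` {1..k}"
  have inj: "inj_on f {1..k}" using assms(1) by (rule strict_mono_on_imp_inj_on)
  have "\<Union>(subpartition ?A \<sigma>) = ?A \<inter> \<Union>\<sigma>"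
    unfolding subpartition_def by blast
  then have U: "\<Union>(subpartition ?A \<sigma>) = ?A"
    using assms(2) by blast
  have rank: "card {y \<in> ?A. y \<le> f i} = i" if i: "i \<in> {1..k}" for i
  proof -
    have "{y \<in> ?A. y \<le> f i} = f ` {1..i}"
      using i by (auto simp: strict_mono_on_less_eq[OF assms(1)])
    moreover have "inj_on f {1..i}" by (rule inj_on_subset[OF inj]) (use i in simp)
    ultimately show ?thesis by (simp add: card_image)
  qed
  have img: "(\<lambda>x. card {y \<in> ?A. y \<le> x}) ` (?A \<inter> B) = {i \<in> {1..k}. f i \<in> B}" for B
  proof -
    have "?A \<inter> B = f ` {i \<in> {1..k}. f i \<in> B}" by auto
    then have "(\<lambda>x. card {y \<in> ?A. y \<le> x}) ` (?A \<inter> B) =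
        (\<lambda>i. card {y \<in> ?A. y \<le> f i}) ` {i \<in> {1..k}. f i \<in> B}" by (simp add: image_image)
    also have "\<dots> = (\<lambda>i. i) ` {i \<in> {1..k}. f i \<in> B}"
      by (rule image_cong[OF refl], rule rank) simp
    finally show ?thesis by simp
  qed
  have sub: "subpartition ?A \<sigma> = (\<lambda>B. ?A \<inter> B) ` {B \<in> \<sigma>. ?A \<inter> B \<noteq> {}}"
    unfolding subpartition_def by blast
  have "standardize (subpartition ?A \<sigma>) =
      (\<lambda>B. (\<lambda>x. card {y \<in> ?A. y \<le> x}) ` B) ` subpartition ?A \<sigma>"
    unfolding standardize_def U Let_def ..
  also have "\<dots> = (\<lambda>B. {i \<in> {1..k}. f i \<in> B}) ` {B \<in> \<sigma>. ?A \<inter> B \<noteq> {}}"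
    unfolding sub image_image[where f = "\<lambda>B. (\<lambda>x. card {y \<in> ?A. y \<le> x}) ` B"] img ..
  also have "\<dots> = (\<lambda>B. {i \<in> {1..k}. f i \<in> B}) ` \<sigma> - {{}}" by blast
  finally show ?thesis .
qed

lemma partition_on_vimage:
  assumes "partition_on A \<sigma>" "f ` I \<subseteq> A"
  shows "partition_on I ((\<lambda>B. {i \<in> I. f i \<in> B}) ` \<sigma> - {{}})"
proof (rule partition_onI)
  show "\<Union>((\<lambda>B. {i \<in> I. f i \<in> B}) ` \<sigma> - {{}}) = I"
  proof
    show "I \<subseteq> \<Union>((\<lambda>B. {i \<in> I. f i \<in> B}) ` \<sigma> - {{}})"
    proof
      fix i assume i: "i \<in> I"
      then obtain B where "B \<in> \<sigma>" "f i \<in> B"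
        using assms(2) partition_onD1[OF assms(1)] by blast
      with i show "i \<in> \<Union>((\<lambda>B. {i \<in> I. f i \<in> B}) ` \<sigma> - {{}})" by blast
    qed
  qed blast
  show "disjnt p q" if "p \<in> (\<lambda>B. {i \<in> I. f i \<in> B}) ` \<sigma> - {{}}"
    "q \<in> (\<lambda>B. {i \<in> I. f i \<in> B}) ` \<sigma> - {{}}" "p \<noteq> q" for p q
    using that block_of_eq[OF assms(1)] unfolding disjnt_def by blast
qed auto

text \<open>Both sides are partitions of \<open>{1..k}\<close>, hence equal as soon as their
  same-block relations agree; for the pull-back this is the relation of \<sigma> at the images under
  \<open>f\<close>.\<close>

lemma standardize_subpartition_eq_iff:
  fixes f :: "nat \<Rightarrow> nat"
  assumes "partition_on {1..n} \<sigma>" "partition_on {1..k} \<pi>"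
    and "strict_mono_on {1..k} f" "f ` {1..k} \<subseteq> {1..n}"
  shows "standardize (subpartition (f ` {1..k}) \<sigma>) = \<pi> \<longleftrightarrow>
    (\<forall>i\<in>{1..k}. \<forall>j\<in>{1..k}. block_of \<sigma> (f i) = block_of \<sigma> (f j) \<longleftrightarrow>
       block_of \<pi> i = block_of \<pi> j)"
proof -
  let ?\<tau> = "(\<lambda>B. {i \<in> {1..k}. f i \<in> B}) ` \<sigma> - {{}}"
  have \<tau>: "standardize (subpartition (f ` {1..k}) \<sigma>) = ?\<tau>"
    using assms partition_onD1[OF assms(1)] by (intro standardize_subpartition) auto
  have part: "partition_on {1..k} ?\<tau>" by (rule partition_on_vimage) fact+
  have eq: "block_of ?\<tau> i = block_of ?\<tau> j \<longleftrightarrow> block_of \<sigma> (f i) = block_of \<sigma> (f j)"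
    if "i \<in> {1..k}" "j \<in> {1..k}" for i j
  proof -
    have fi: "f i \<in> {1..n}" "f j \<in> {1..n}" using that assms(4) by blast+
    have "(\<exists>C\<in>?\<tau>. i \<in> C \<and> j \<in> C) \<longleftrightarrow> (\<exists>B\<in>\<sigma>. f i \<in> B \<and> f j \<in> B)" (is "?l \<longleftrightarrow> ?r")
    proof
      assume ?l
      then obtain B where "B \<in> \<sigma>" "i \<in> {i \<in> {1..k}. f i \<in> B}" "j \<in> {i \<in> {1..k}. f i \<in> B}"
        by (elim bexE DiffE imageE) simp
      then show ?r by (intro bexI[of _ B]) simp_all
    next
      assume ?r
      then obtain B where B: "B \<in> \<sigma>" "f i \<in> B" "f j \<in> B" by (elim bexE conjE)
      let ?C = "{i \<in> {1..k}. f i \<in> B}"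
      have C: "i \<in> ?C" "j \<in> ?C" using that B by simp_all
      then have "?C \<noteq> {}" by (metis empty_iff)
      then have "?C \<in> ?\<tau>" using B(1) by simp
      with C show ?l by (intro bexI[of _ ?C] conjI)
    qed
    then show ?thesis
      by (simp only: block_of_eq_iff[OF part that] block_of_eq_iff[OF assms(1) fi])
  qed
  show ?thesis unfolding \<tau>
  proof
    assume R: "?\<tau> = \<pi>"
    show "\<forall>i\<in>{1..k}. \<forall>j\<in>{1..k}. block_of \<sigma> (f i) = block_of \<sigma> (f j) \<longleftrightarrow>
       block_of \<pi> i = block_of \<pi> j"
      using eq unfolding R by blast
  next
    assume R: "\<forall>i\<in>{1..k}. \<forall>j\<in>{1..k}. block_of \<sigma> (f i) = block_of \<sigma> (f j) \<longleftrightarrow>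
       block_of \<pi> i = block_of \<pi> j"
    show "?\<tau> = \<pi>"
    proof (rule partition_on_eqI[OF part assms(2)])
      fix i j assume ij: "i \<in> {1..k}" "j \<in> {1..k}"
      show "block_of ?\<tau> i = block_of ?\<tau> j \<longleftrightarrow> block_of \<pi> i = block_of \<pi> j"
        unfolding eq[OF ij] using R ij by blast
    qed
  qed
qed

section \<open>Containment as an increasing map and as a subsequence\<close>

lemma obtain_strict_mono_image:
  fixes A :: "nat set"
  assumes "finite A"
  obtains f where "strict_mono_on {1..card A} f" "f ` {1..card A} = A"
proof -
  let ?l = "sorted_list_of_set A"
  have len: "length ?l = card A" using assms by simp
  have mono: "strict_mono_on {1..card A} (\<lambda>i. ?l ! (i - 1))"
  proof (rule strict_mono_onI)
    fix i j assume "i \<in> {1..card A}" "j \<in> {1..card A}" "i < j"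
    then have "i - 1 < j - 1" "j - 1 < length ?l" unfolding len by auto
    then show "?l ! (i - 1) < ?l ! (j - 1)"
      by (rule sorted_wrt_nth_less[OF strict_sorted_list_of_set])
  qed
  have "(\<lambda>i. ?l ! (i - 1)) ` {1..card A} = (\<lambda>i. ?l ! i) ` {..<card A}"
    unfolding image_Suc_lessThan[symmetric] image_image by simp
  also have "\<dots> = set ?l" unfolding set_conv_nth len by blast
  also have "\<dots> = A" using assms by simp
  finally show ?thesis by (rule that[OF mono])
qed

lemma contains_iff:
  assumes "partition_on {1..n} \<sigma>" "partition_on {1..k} \<pi>"
  shows "contains \<sigma> \<pi> \<longleftrightarrow> (\<exists>f. strict_mono_on {1..k} f \<and> f ` {1..k} \<subseteq> {1..n} \<and>
    (\<forall>i\<in>{1..k}. \<forall>j\<in>{1..k}. block_of \<sigma> (f i) = block_of \<sigma> (f j) \<longleftrightarrow>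
       block_of \<pi> i = block_of \<pi> j))" (is "_ \<longleftrightarrow> (\<exists>f. ?P f)")
proof
  assume "contains \<sigma> \<pi>"
  then obtain A where A: "A \<subseteq> {1..n}" "standardize (subpartition A \<sigma>) = \<pi>"
    unfolding contains_def using partition_onD1[OF assms(1)] by auto
  have "finite A" using A(1) by (rule finite_subset) simp
  then obtain f where f: "strict_mono_on {1..card A} f" "f ` {1..card A} = A"
    by (rule obtain_strict_mono_image)
  \<comment> \<open>\<open>contains\<close> does not fix the size of \<open>A\<close>; it follows
    because the standardized partition has ground set \<open>{1..card A}\<close> and \<pi> has
    ground set \<open>{1..k}\<close>.\<close>
  have "\<pi> = (\<lambda>B. {i \<in> {1..card A}. f i \<in> B}) ` \<sigma> - {{}}"
    using standardize_subpartition[OF f(1), of \<sigma>] A f(2) partition_onD1[OF assms(1)] by simp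
  then have "partition_on {1..card A} \<pi>"
    using partition_on_vimage[OF assms(1), of f "{1..card A}"] A f(2) by simp
  then have "{1..card A} = {1..k}" using assms(2) by (simp add: partition_on_def)
  then have k: "card A = k" by (metis card_atLeastAtMost diff_Suc_1)
  have "?P f"
    using standardize_subpartition_eq_iff[OF assms, of f] f A unfolding k by simp
  then show "\<exists>f. ?P f" by (intro exI[of _ f])
next
  assume "\<exists>f. ?P f"
  then obtain f where "?P f" ..
  then have "standardize (subpartition (f ` {1..k}) \<sigma>) = \<pi>" "f ` {1..k} \<subseteq> \<Union>\<sigma>"
    using standardize_subpartition_eq_iff[OF assms, of f] unfolding partition_onD1[OF assms(1)]
    by blast+
  then show "contains \<sigma> \<pi>" unfolding contains_def by blast
qed

text \<open>Forward, the index map is built along the derivation of \<open>subseq\<close>; backward,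
  the induction on \<open>w\<close> asks whether the map uses position 0.\<close>

lemma subseq_iff_nth:
  "subseq u w \<longleftrightarrow> (\<exists>f. strict_mono_on {..<length u} f \<and>
     (\<forall>i<length u. f i < length w \<and> u ! i = w ! f i))"
proof
  assume "subseq u w"
  then show "\<exists>f. strict_mono_on {..<length u} f \<and>
     (\<forall>i<length u. f i < length w \<and> u ! i = w ! f i)"
  proof (induction rule: list_emb.induct)
    case (list_emb_Nil ys)
    show ?case by (simp add: strict_mono_on_def)
  next
    case (list_emb_Cons xs ys y)
    then obtain f where "strict_mono_on {..<length xs} f"
      "\<forall>i<length xs. f i < length ys \<and> xs ! i = ys ! f i" by blast
    then show ?case
      by (intro exI[of _ "\<lambda>i. Suc (f i)"]) (simp add: strict_mono_on_def)
  next
    case (list_emb_Cons2 x y xs ys)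
    then obtain f where "strict_mono_on {..<length xs} f"
      "\<forall>i<length xs. f i < length ys \<and> xs ! i = ys ! f i" by blast
    with list_emb_Cons2.hyps show ?case
      by (intro exI[of _ "\<lambda>i. case i of 0 \<Rightarrow> 0 | Suc i \<Rightarrow> Suc (f i)"])
        (auto simp: strict_mono_on_def less_Suc_eq_0_disj split: nat.splits)
  qed
next
  have "\<lbrakk>strict_mono_on {..<length u} f; \<forall>i<length u. f i < length w \<and> u ! i = w ! f i\<rbrakk>
      \<Longrightarrow> subseq u w" for f
  proof (induction w arbitrary: u f)
    case Nil
    then show ?case by (cases u) auto
  next
    case (Cons y w)
    show ?case
    proof (cases u)
      case u: (Cons x v)
      \<comment> \<open>Strict monotonicity keeps every later index positive, so the map can be
        lowered by one to address the tail \<open>w\<close>.\<close>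
      have pos: "0 < f (Suc i)" if "i < length v" for i
        using strict_mono_onD[OF Cons.prems(1), of 0 "Suc i"] that u by auto
      show ?thesis
      proof (cases "f 0")
        case 0
        have "subseq v w"
        proof (rule Cons.IH)
          show "strict_mono_on {..<length v} (\<lambda>i. f (Suc i) - 1)"
            using pos strict_mono_onD[OF Cons.prems(1)] u
            by (intro strict_mono_onI) (auto intro!: diff_less_mono simp: Suc_le_eq)
          show "\<forall>i<length v. f (Suc i) - 1 < length w \<and> v ! i = w ! (f (Suc i) - 1)"
          proof (intro allI impI)
            fix i assume i: "i < length v"
            with pos obtain j where j: "f (Suc i) = Suc j" by (metis gr0_implies_Suc)
            from Cons.prems(2)[rule_format, of "Suc i"] i u j
            show "f (Suc i) - 1 < length w \<and> v ! i = w ! (f (Suc i) - 1)" by simp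
          qed
        qed
        moreover have "x = y" using Cons.prems(2)[rule_format, of 0] u 0 by simp
        ultimately show ?thesis using u by simp
      next
        case (Suc m)
        have pos': "0 < f i" if "i < length u" for i
          using pos Suc that u by (cases i) auto
        have "subseq u w"
        proof (rule Cons.IH)
          show "strict_mono_on {..<length u} (\<lambda>i. f i - 1)"
            using pos' strict_mono_onD[OF Cons.prems(1)]
            by (intro strict_mono_onI) (auto intro!: diff_less_mono simp: Suc_le_eq)
          show "\<forall>i<length u. f i - 1 < length w \<and> u ! i = w ! (f i - 1)"
          proof (intro allI impI)
            fix i assume i: "i < length u"
            with pos' obtain j where j: "f i = Suc j" by (metis gr0_implies_Suc)
            from Cons.prems(2)[rule_format, of i] i j
            show "f i - 1 < length w \<and> u ! i = w ! (f i - 1)" by simp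
          qed
        qed
        then show ?thesis by (rule list_emb_Cons)
      qed
    qed simp
  qed
  then show "\<exists>f. strict_mono_on {..<length u} f \<and>
     (\<forall>i<length u. f i < length w \<and> u ! i = w ! f i) \<Longrightarrow> subseq u w" by blast
qed

text \<open>Elements in a common block are positions with equal letters, so an occurrence of the
  pattern is a subsequence with the same equalities among its letters.\<close>

lemma contains_iff_subseq:
  assumes "partition_on {1..n} \<sigma>" "partition_on {1..k} \<pi>"
  shows "contains \<sigma> \<pi> \<longleftrightarrow> (\<exists>u. subseq u (word_of n \<sigma>) \<and> length u = k \<and>
    (\<forall>i<k. \<forall>j<k. u ! i = u ! j \<longleftrightarrow> (\<exists>B\<in>\<pi>. Suc i \<in> B \<and> Suc j \<in> B)))"
proof
  assume "contains \<sigma> \<pi>"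
  then obtain f where f: "strict_mono_on {1..k} f" "f ` {1..k} \<subseteq> {1..n}"
    "\<forall>i\<in>{1..k}. \<forall>j\<in>{1..k}. block_of \<sigma> (f i) = block_of \<sigma> (f j) \<longleftrightarrow>
       block_of \<pi> i = block_of \<pi> j"
    unfolding contains_iff[OF assms] by blast
  have rng: "1 \<le> f (Suc i)" "f (Suc i) \<le> n" if "i < k" for i
    using f(2) that by (auto simp: image_subset_iff)
  \<comment> \<open>Elements count from 1 and list positions from 0, so the map is shifted in its
    argument and in its value.\<close>
  define g where "g i = f (Suc i) - 1" for i
  have g: "Suc (g i) = f (Suc i)" "g i < n" if "i < k" for i
    using rng[OF that] by (auto simp: g_def)
  have mono: "strict_mono_on {..<k} g"
  proof (rule strict_mono_onI)
    fix i j assume ij: "i \<in> {..<k}" "j \<in> {..<k}" "i < j"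
    then have "f (Suc i) < f (Suc j)" by (intro strict_mono_onD[OF f(1)]) auto
    then show "g i < g j" using ij(1,2) by (simp flip: g(1))
  qed
  define u where "u = map (\<lambda>i. word_of n \<sigma> ! g i) [0..<k]"
  have "subseq u (word_of n \<sigma>)" unfolding subseq_iff_nth
    using mono g by (intro exI[of _ g]) (simp add: u_def)
  moreover have "u ! i = u ! j \<longleftrightarrow> (\<exists>B\<in>\<pi>. Suc i \<in> B \<and> Suc j \<in> B)"
    if ij: "i < k" "j < k" for i j
  proof -
    have "u ! i = u ! j \<longleftrightarrow> block_of \<sigma> (f (Suc i)) = block_of \<sigma> (f (Suc j))"
      using ij g word_of_eq_iff[OF assms(1), of "g i" "g j"] by (simp add: u_def)
    also have "\<dots> \<longleftrightarrow> block_of \<pi> (Suc i) = block_of \<pi> (Suc j)" using f(3) ij by simp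
    also have "\<dots> \<longleftrightarrow> (\<exists>B\<in>\<pi>. Suc i \<in> B \<and> Suc j \<in> B)"
      using ij by (intro block_of_eq_iff[OF assms(2)]) auto
    finally show ?thesis .
  qed
  ultimately show "\<exists>u. subseq u (word_of n \<sigma>) \<and> length u = k \<and>
    (\<forall>i<k. \<forall>j<k. u ! i = u ! j \<longleftrightarrow> (\<exists>B\<in>\<pi>. Suc i \<in> B \<and> Suc j \<in> B))"
    by (intro exI[of _ u]) (simp add: u_def)
next
  assume "\<exists>u. subseq u (word_of n \<sigma>) \<and> length u = k \<and>
    (\<forall>i<k. \<forall>j<k. u ! i = u ! j \<longleftrightarrow> (\<exists>B\<in>\<pi>. Suc i \<in> B \<and> Suc j \<in> B))"
  then obtain u where u: "subseq u (word_of n \<sigma>)" "length u = k"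
    "\<forall>i<k. \<forall>j<k. u ! i = u ! j \<longleftrightarrow> (\<exists>B\<in>\<pi>. Suc i \<in> B \<and> Suc j \<in> B)" by blast
  from u(1) obtain g where g: "strict_mono_on {..<k} g"
    "\<And>i. i < k \<Longrightarrow> g i < n \<and> u ! i = word_of n \<sigma> ! g i"
    unfolding subseq_iff_nth using u(2) by auto
  define f where "f i = Suc (g (i - 1))" for i
  have mono: "strict_mono_on {1..k} f"
    by (rule strict_mono_onI) (auto simp: f_def intro!: strict_mono_onD[OF g(1)])
  have rng: "f ` {1..k} \<subseteq> {1..n}" using g(2) by (auto simp: f_def Suc_le_eq)
  have "block_of \<sigma> (f i) = block_of \<sigma> (f j) \<longleftrightarrow> block_of \<pi> i = block_of \<pi> j"
    if ij: "i \<in> {1..k}" "j \<in> {1..k}" for i j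
  proof -
    obtain i' j' where s: "i = Suc i'" "j = Suc j'" "i' < k" "j' < k"
      using ij by (cases i; cases j) auto
    have "block_of \<sigma> (f i) = block_of \<sigma> (f j) \<longleftrightarrow> u ! i' = u ! j'"
      using s g(2) word_of_eq_iff[OF assms(1), of "g i'" "g j'"] by (simp add: f_def)
    also have "\<dots> \<longleftrightarrow> (\<exists>B\<in>\<pi>. i \<in> B \<and> j \<in> B)" using u(3) s by simp
    also have "\<dots> \<longleftrightarrow> block_of \<pi> i = block_of \<pi> j"
      using block_of_eq_iff[OF assms(2) ij] by simp
    finally show ?thesis .
  qed
  with mono rng show "contains \<sigma> \<pi>" unfolding contains_iff[OF assms] by blast
qed

lemma contains_124_3:
  assumes "partition_on {1..n} \<sigma>"
  shows "contains \<sigma> {{1, 2, 4}, {3}} \<longleftrightarrow> \<not> avoids_aaba (word_of n \<sigma>)"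
proof -
  have "{1..4::nat} = {1, 2, 3, 4}" by auto
  then have p: "partition_on {1..4} {{1, 2, 4}, {3::nat}}"
    by (auto simp: partition_on_def disjoint_def)
  show ?thesis
  proof
    assume "contains \<sigma> {{1, 2, 4}, {3}}"
    then obtain u where u: "subseq u (word_of n \<sigma>)" "length u = 4"
      "\<forall>i<4. \<forall>j<4. u ! i = u ! j \<longleftrightarrow> (\<exists>B\<in>{{1, 2, 4}, {3}}. Suc i \<in> B \<and> Suc j \<in> B)"
      unfolding contains_iff_subseq[OF assms p] by blast
    \<comment> \<open>Comparisons with position 0 already pin down the shape aaba: positions 1 and 3
      repeat its letter and position 2 differs.\<close>
    from u(3)[rule_format, of 0 1] u(3)[rule_format, of 0 3] u(3)[rule_format, of 0 2]
    have "u ! 1 = u ! 0" "u ! 3 = u ! 0" "u ! 0 \<noteq> u ! 2" by auto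
    moreover have "u = [u ! 0, u ! 1, u ! 2, u ! 3]"
      using u(2) by (auto simp: numeral_eq_Suc length_Suc_conv)
    ultimately show "\<not> avoids_aaba (word_of n \<sigma>)"
      using u(1) unfolding avoids_aaba_def by metis
  next
    assume "\<not> avoids_aaba (word_of n \<sigma>)"
    then obtain a b where "subseq [a, a, b, a] (word_of n \<sigma>)" "a \<noteq> b"
      unfolding avoids_aaba_def by blast
    then show "contains \<sigma> {{1, 2, 4}, {3}}"
      unfolding contains_iff_subseq[OF assms p]
      by (intro exI[of _ "[a, a, b, a]"]) (simp add: numeral_eq_Suc All_less_Suc2)
  qed
qed

lemma contains_134_2:
  assumes "partition_on {1..n} \<sigma>"
  shows "contains \<sigma> {{1, 3, 4}, {2}} \<longleftrightarrow> \<not> avoids_abaa (word_of n \<sigma>)"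
proof -
  have "{1..4::nat} = {1, 2, 3, 4}" by auto
  then have p: "partition_on {1..4} {{1, 3, 4}, {2::nat}}"
    by (auto simp: partition_on_def disjoint_def)
  show ?thesis
  proof
    assume "contains \<sigma> {{1, 3, 4}, {2}}"
    then obtain u where u: "subseq u (word_of n \<sigma>)" "length u = 4"
      "\<forall>i<4. \<forall>j<4. u ! i = u ! j \<longleftrightarrow> (\<exists>B\<in>{{1, 3, 4}, {2}}. Suc i \<in> B \<and> Suc j \<in> B)"
      unfolding contains_iff_subseq[OF assms p] by blast
    from u(3)[rule_format, of 0 2] u(3)[rule_format, of 0 3] u(3)[rule_format, of 0 1]
    have "u ! 2 = u ! 0" "u ! 3 = u ! 0" "u ! 0 \<noteq> u ! 1" by auto
    moreover have "u = [u ! 0, u ! 1, u ! 2, u ! 3]"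
      using u(2) by (auto simp: numeral_eq_Suc length_Suc_conv)
    ultimately show "\<not> avoids_abaa (word_of n \<sigma>)"
      using u(1) unfolding avoids_abaa_def by metis
  next
    assume "\<not> avoids_abaa (word_of n \<sigma>)"
    then obtain a b where "subseq [a, b, a, a] (word_of n \<sigma>)" "a \<noteq> b"
      unfolding avoids_abaa_def by blast
    then show "contains \<sigma> {{1, 3, 4}, {2}}"
      unfolding contains_iff_subseq[OF assms p]
      by (intro exI[of _ "[a, b, a, a]"]) (simp add: numeral_eq_Suc All_less_Suc2)
  qed
qed

text \<open>Words of partitions are exactly the restricted growth functions, and containment can be
  read off the word alone; this removes partitions from the count.\<close>

lemma avoiding_words_eq:
  assumes "\<And>\<sigma>. partition_on {1..n} \<sigma> \<Longrightarrow> contains \<sigma> \<pi> \<longleftrightarrow> \<not> P (word_of n \<sigma>)"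
  shows "avoiding_words n \<pi> = {w. length w = n \<and> rgf {} w \<and> P w}"
proof
  show "avoiding_words n \<pi> \<subseteq> {w. length w = n \<and> rgf {} w \<and> P w}"
    using assms rgf_word_of
    by (auto simp: avoiding_words_def avoiders_def set_partitions_def)
  show "{w. length w = n \<and> rgf {} w \<and> P w} \<subseteq> avoiding_words n \<pi>"
  proof
    fix w assume w: "w \<in> {w. length w = n \<and> rgf {} w \<and> P w}"
    then obtain \<sigma> where "partition_on {1..n} \<sigma>" "word_of n \<sigma> = w"
      by (auto elim: rgf_imp_word_of)
    with w assms show "w \<in> avoiding_words n \<pi>"
      by (auto simp: avoiding_words_def avoiders_def set_partitions_def)
  qed
qed

section \<open>Comparing the two counts\<close>

lemma bij_betw_restrict:
  assumes "bij_betw f A B" "\<And>x. x \<in> A \<Longrightarrow> Q (f x) \<longleftrightarrow> P x"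
  shows "bij_betw f {x \<in> A. P x} {y \<in> B. Q y}"
proof (rule bij_betw_subset[OF assms(1)])
  have "f ` A = B" using assms(1) by (rule bij_betw_imp_surj_on)
  then show "f ` {x \<in> A. P x} = {y \<in> B. Q y}" using assms(2) by blast
qed blast

theorem theorem5p2:
  fixes n :: nat and k :: int
  assumes "n \<ge> 1"
  shows "card {w \<in> avoiding_words n {{1, 2, 4}, {3}}. int (ls w) = k}
       = card {w \<in> avoiding_words n {{1, 3, 4}, {2}}. int (ls w) = k}"
proof -
  \<comment> \<open>\<open>Q\<close> expresses \<open>P\<close> through the compressed word and the
    multiset: the deletions preserve and reflect the growth condition, \<open>size M\<close> is the
    length, and \<open>ls\<close> of a restricted growth function is a sum over
    \<open>M\<close>.\<close>
  define Q :: "nat list \<times> nat multiset \<Rightarrow> bool" where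
    "Q = (\<lambda>(c, M). rgf {} c \<and> size M = n \<and> int (\<Sum>x\<in>#M. x - 1) = k)"
  define P where "P w \<longleftrightarrow> length w = n \<and> rgf {} w \<and> int (ls w) = k" for w
  let ?X = "{(c :: nat list, M). \<forall>a. count (mset c) a = min 2 (count M a)}"
  have aaba: "bij_betw (\<lambda>w. (rev (last_two (rev w)), mset w))
      {w \<in> {w. avoids_aaba w}. P w} {y \<in> ?X. Q y}"
    by (rule bij_betw_restrict[OF bij_betw_first_two])
      (auto simp: P_def Q_def rgf_first_two ls_rgf)
  have abaa: "bij_betw (\<lambda>w. (last_two w, mset w))
      {w \<in> {w. avoids_abaa w}. P w} {y \<in> ?X. Q y}"
    by (rule bij_betw_restrict[OF bij_betw_last_two])
      (auto simp: P_def Q_def rgf_last_two ls_rgf)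
  \<comment> \<open>Both bijections end in the same set of pairs.\<close>
  have "card {w \<in> {w. avoids_aaba w}. P w} = card {w \<in> {w. avoids_abaa w}. P w}"
    using bij_betw_same_card[OF aaba] bij_betw_same_card[OF abaa] by (rule trans[OF _ sym])
  moreover have "{w \<in> avoiding_words n {{1, 2, 4}, {3}}. int (ls w) = k} =
      {w \<in> {w. avoids_aaba w}. P w}"
  proof -
    have "avoiding_words n {{1, 2, 4}, {3}} = {w. length w = n \<and> rgf {} w \<and> avoids_aaba w}"
      by (rule avoiding_words_eq) (rule contains_124_3)
    then show ?thesis unfolding P_def by blast
  qed
  moreover have "{w \<in> avoiding_words n {{1, 3, 4}, {2}}. int (ls w) = k} =
      {w \<in> {w. avoids_abaa w}. P w}"
  proof -
    have "avoiding_words n {{1, 3, 4}, {2}} = {w. length w = n \<and> rgf {} w \<and> avoids_abaa w}"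
      by (rule avoiding_words_eq) (rule contains_134_2)
    then show ?thesis unfolding P_def by blast
  qed
  ultimately show ?thesis by simp
qed

end
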